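(* Let $G=(V,E)$ be a directed graph with $n$ vertices and $m$ edges, each edge carrying a real (positive or negative) weight, let $s\in V$ be a distinguished source vertex, and let $t$ be a positive integer. Then one can compute, in $O((t+1)(m+n))$ total time, for every vertex $v\in V$ different from $s$, an upper bound on the shortest-path distance from $s$ to $v$ that does not exceed the length of a shortest path among all $t+$light directed paths from $s$ to $v$.
   Context: The length of a directed path is the sum of the weights of its edges. A directed path from $u$ to $v$ is lightest if it has the smallest possible number of edges among all directed paths from $u$ to $v$. For a nonnegative integer $t$, a directed path from $u$ to $v$ is $t+$light if it has at most $t$ more edges than a lightest directed path from $u$ to $v$. *)

theory Defs
  imports "Graph_Theory.Graph_Theory"
begin

text \<open>
  Directed paths are the arc walks of \<^const>\<open>pre_digraph.awalk\<close>, their length is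
  \<^const>\<open>wf_digraph.awalk_cost\<close>, and the distance is \<^const>\<open>wf_digraph.\<mu>\<close>, the infimum over
  all walks. It is \<open>\<infinity>\<close> if there is no walk and \<open>-\<infinity>\<close> if some walk meets a negative cycle.
\<close>

context wf_digraph
begin

definition lightest :: "'a \<Rightarrow> 'b awalk \<Rightarrow> 'a \<Rightarrow> bool" where
  "lightest u p v \<longleftrightarrow> awalk u p v \<and> (\<forall>q. awalk u q v \<longrightarrow> length p \<le> length q)"

definition plus_light :: "nat \<Rightarrow> 'a \<Rightarrow> 'b awalk \<Rightarrow> 'a \<Rightarrow> bool" where
  "plus_light t u p v \<longleftrightarrow>
     awalk u p v \<and> (\<exists>q. lightest u q v \<and> length p \<le> length q + t)"

definition plus_light_dist :: "nat \<Rightarrow> 'b weight_fun \<Rightarrow> 'a \<Rightarrow> 'a \<Rightarrow> ereal" where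
  "plus_light_dist t w u v = (INF p \<in> {p. plus_light t u p v}. ereal (awalk_cost w p))"

end

text \<open>
  The machine model is a unit-cost real RAM, programmed in a small imperative language.
  It has registers and arrays of natural numbers, which serve for indexing, and
  registers and arrays of reals. On naturals it can add, subtract (truncating at 0) and
  compare; on reals only add and compare. There is no conversion between the two sorts and no
  multiplication, so unit cost gives no hidden power. Arrays are not bounds-checked, and memory
  need not be initialised.
\<close>

type_synonym vname = string

record state =
  nreg :: "vname \<Rightarrow> nat"
  narr :: "vname \<Rightarrow> nat \<Rightarrow> nat"
  rreg :: "vname \<Rightarrow> real"
  rarr :: "vname \<Rightarrow> nat \<Rightarrow> real"

datatype nexp = NConst nat | NReg vname | NArr vname nexp | NAdd nexp nexp | NSub nexp nexp

datatype rexp = RZero | RReg vname | RArr vname nexp | RAdd rexp rexp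

datatype bexp = NLess nexp nexp | RLess rexp rexp | BNot bexp | BAnd bexp bexp

datatype com =
    Skip
  | NSet vname nexp
  | NPut vname nexp nexp
  | RSet vname rexp
  | RPut vname nexp rexp
  | Seq com com
  | Cond bexp com com
  | While bexp com

primrec nval :: "nexp \<Rightarrow> state \<Rightarrow> nat" where
  "nval (NConst k) \<sigma> = k"
| "nval (NReg x) \<sigma> = nreg \<sigma> x"
| "nval (NArr x e) \<sigma> = narr \<sigma> x (nval e \<sigma>)"
| "nval (NAdd d e) \<sigma> = nval d \<sigma> + nval e \<sigma>"
| "nval (NSub d e) \<sigma> = nval d \<sigma> - nval e \<sigma>"

primrec rval :: "rexp \<Rightarrow> state \<Rightarrow> real" where
  "rval RZero \<sigma> = 0"
| "rval (RReg x) \<sigma> = rreg \<sigma> x"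
| "rval (RArr x e) \<sigma> = rarr \<sigma> x (nval e \<sigma>)"
| "rval (RAdd d e) \<sigma> = rval d \<sigma> + rval e \<sigma>"

primrec bval :: "bexp \<Rightarrow> state \<Rightarrow> bool" where
  "bval (NLess d e) \<sigma> \<longleftrightarrow> nval d \<sigma> < nval e \<sigma>"
| "bval (RLess d e) \<sigma> \<longleftrightarrow> rval d \<sigma> < rval e \<sigma>"
| "bval (BNot b) \<sigma> \<longleftrightarrow> \<not> bval b \<sigma>"
| "bval (BAnd b c) \<sigma> \<longleftrightarrow> bval b \<sigma> \<and> bval c \<sigma>"

text \<open>Every operator, constant, register access and array access costs one unit.\<close>

primrec ncost :: "nexp \<Rightarrow> nat" where
  "ncost (NConst k) = 1"
| "ncost (NReg x) = 1"
| "ncost (NArr x e) = ncost e + 1"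
| "ncost (NAdd d e) = ncost d + ncost e + 1"
| "ncost (NSub d e) = ncost d + ncost e + 1"

primrec rcost :: "rexp \<Rightarrow> nat" where
  "rcost RZero = 1"
| "rcost (RReg x) = 1"
| "rcost (RArr x e) = ncost e + 1"
| "rcost (RAdd d e) = rcost d + rcost e + 1"

primrec bcost :: "bexp \<Rightarrow> nat" where
  "bcost (NLess d e) = ncost d + ncost e + 1"
| "bcost (RLess d e) = rcost d + rcost e + 1"
| "bcost (BNot b) = bcost b + 1"
| "bcost (BAnd b c) = bcost b + bcost c + 1"

text \<open>
  \<open>exec c \<sigma> T \<sigma>'\<close>: started in \<open>\<sigma>\<close>, the program \<open>c\<close> halts in \<open>\<sigma>'\<close> after exactly \<open>T\<close> units of time.
\<close>

inductive exec :: "com \<Rightarrow> state \<Rightarrow> nat \<Rightarrow> state \<Rightarrow> bool" where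
  Skip: "exec Skip \<sigma> 1 \<sigma>"
| NSet: "exec (NSet x e) \<sigma> (ncost e + 1) (\<sigma>\<lparr>nreg := (nreg \<sigma>)(x := nval e \<sigma>)\<rparr>)"
| NPut: "exec (NPut x i e) \<sigma> (ncost i + ncost e + 1)
           (\<sigma>\<lparr>narr := (narr \<sigma>)(x := (narr \<sigma> x)(nval i \<sigma> := nval e \<sigma>))\<rparr>)"
| RSet: "exec (RSet x e) \<sigma> (rcost e + 1) (\<sigma>\<lparr>rreg := (rreg \<sigma>)(x := rval e \<sigma>)\<rparr>)"
| RPut: "exec (RPut x i e) \<sigma> (ncost i + rcost e + 1)
           (\<sigma>\<lparr>rarr := (rarr \<sigma>)(x := (rarr \<sigma> x)(nval i \<sigma> := rval e \<sigma>))\<rparr>)"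
| Seq: "exec c \<sigma> T \<sigma>' \<Longrightarrow> exec d \<sigma>' T' \<sigma>'' \<Longrightarrow> exec (Seq c d) \<sigma> (T + T') \<sigma>''"
| CondTrue: "bval b \<sigma> \<Longrightarrow> exec c \<sigma> T \<sigma>' \<Longrightarrow> exec (Cond b c d) \<sigma> (bcost b + T + 1) \<sigma>'"
| CondFalse: "\<not> bval b \<sigma> \<Longrightarrow> exec d \<sigma> T \<sigma>' \<Longrightarrow> exec (Cond b c d) \<sigma> (bcost b + T + 1) \<sigma>'"
| WhileFalse: "\<not> bval b \<sigma> \<Longrightarrow> exec (While b c) \<sigma> (bcost b + 1) \<sigma>"
| WhileTrue: "bval b \<sigma> \<Longrightarrow> exec c \<sigma> T \<sigma>' \<Longrightarrow> exec (While b c) \<sigma>' T' \<sigma>'' \<Longrightarrow>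
    exec (While b c) \<sigma> (bcost b + T + T' + 1) \<sigma>''"

inductive_cases exec_SkipE: "exec Skip \<sigma> T \<sigma>'"
inductive_cases exec_NSetE: "exec (NSet x e) \<sigma> T \<sigma>'"
inductive_cases exec_NPutE: "exec (NPut x i e) \<sigma> T \<sigma>'"
inductive_cases exec_RSetE: "exec (RSet x e) \<sigma> T \<sigma>'"
inductive_cases exec_RPutE: "exec (RPut x i e) \<sigma> T \<sigma>'"
inductive_cases exec_SeqE: "exec (Seq c d) \<sigma> T \<sigma>'"
inductive_cases exec_CondE: "exec (Cond b c d) \<sigma> T \<sigma>'"
inductive_cases exec_WhileE: "exec (While b c) \<sigma> T \<sigma>'"

lemma exec_deterministic:
  "exec c \<sigma> T \<sigma>' \<Longrightarrow> exec c \<sigma> U \<tau> \<Longrightarrow> U = T \<and> \<tau> = \<sigma>'"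
proof (induction arbitrary: U \<tau> rule: exec.induct)
  case (Seq c \<sigma> T \<sigma>' d T' \<sigma>'')
  from Seq.prems show ?case
  proof (rule exec_SeqE)
    fix T1 \<sigma>1 T2
    assume U: "U = T1 + T2" and ex: "exec c \<sigma> T1 \<sigma>1" "exec d \<sigma>1 T2 \<tau>"
    have "T1 = T \<and> \<sigma>1 = \<sigma>'"
      by (rule Seq.IH(1)) (rule ex(1))
    moreover from this ex(2) have "T2 = T' \<and> \<tau> = \<sigma>''"
      by (intro Seq.IH(2)) simp
    ultimately show ?thesis
      using U by simp
  qed
next
  case (CondTrue b \<sigma> c T \<sigma>' d)
  from CondTrue.prems show ?case
  proof (rule exec_CondE)
    fix T1
    assume U: "U = Suc (bcost b + T1)" and ex: "exec c \<sigma> T1 \<tau>"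
    have "T1 = T \<and> \<tau> = \<sigma>'"
      by (rule CondTrue.IH) (rule ex)
    then show ?thesis
      using U by simp
  qed (use CondTrue.hyps in simp_all)
next
  case (CondFalse b \<sigma> d T \<sigma>' c)
  from CondFalse.prems show ?case
  proof (rule exec_CondE)
    fix T1
    assume U: "U = Suc (bcost b + T1)" and ex: "exec d \<sigma> T1 \<tau>"
    have "T1 = T \<and> \<tau> = \<sigma>'"
      by (rule CondFalse.IH) (rule ex)
    then show ?thesis
      using U by simp
  qed (use CondFalse.hyps in simp_all)
next
  case (WhileFalse b \<sigma> c)
  from WhileFalse.prems show ?case
    by (rule exec_WhileE) (use WhileFalse.hyps in auto)
next
  case (WhileTrue b \<sigma> c T \<sigma>' T' \<sigma>'')
  from WhileTrue.prems show ?case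
  proof (rule exec_WhileE)
    fix T1 \<sigma>1 T2
    assume U: "U = Suc (bcost b + T1 + T2)" and ex: "exec c \<sigma> T1 \<sigma>1" "exec (While b c) \<sigma>1 T2 \<tau>"
    have "T1 = T \<and> \<sigma>1 = \<sigma>'"
      by (rule WhileTrue.IH(1)) (rule ex(1))
    moreover from this ex(2) have "T2 = T' \<and> \<tau> = \<sigma>''"
      by (intro WhileTrue.IH(2)) simp
    ultimately show ?thesis
      using U by simp
  qed (use WhileTrue.hyps in simp)
qed (auto elim: exec_SkipE exec_NSetE exec_NPutE exec_RSetE exec_RPutE)

text \<open>
  The input is an unsorted arc list: vertices and arcs are numbered from 0, and arc \<open>a\<close> runs from
  \<open>tail[a]\<close> to \<open>head[a]\<close> with weight \<open>weight[a]\<close>. All other memory contents are arbitrary.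
\<close>

definition encodes ::
  "state \<Rightarrow> (nat, nat) pre_digraph \<Rightarrow> nat weight_fun \<Rightarrow> nat \<Rightarrow> nat \<Rightarrow> bool" where
  "encodes \<sigma> G w s t \<longleftrightarrow>
     verts G = {..<nreg \<sigma> ''n''} \<and> arcs G = {..<nreg \<sigma> ''m''} \<and>
     (\<forall>a \<in> arcs G. narr \<sigma> ''tail'' a = tail G a \<and> narr \<sigma> ''head'' a = head G a \<and>
        rarr \<sigma> ''weight'' a = w a) \<and>
     nreg \<sigma> ''s'' = s \<and> nreg \<sigma> ''t'' = t"

text \<open>Reals cannot represent \<open>\<infinity>\<close>, so a flag tells whether the reported bound is finite.\<close>

definition bound :: "state \<Rightarrow> nat \<Rightarrow> ereal" where
  "bound \<sigma> v = (if narr \<sigma> ''finite'' v = 0 then \<infinity> else ereal (rarr \<sigma> ''bound'' v))"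

end

theory Submission
  imports Defs
begin

text \<open>
  Breadth-first search from \<open>s\<close> lists the arcs with reachable tail by nondecreasing level of their
  tail, where the level of a vertex is its hop distance from \<open>s\<close>. Then \<open>t + 1\<close> Bellman-Ford passes
  relax all these arcs in that order. A bound is always the cost of some walk. Conversely, number
  the passes from 0. When pass \<open>k\<close> reaches the arcs out of \<open>v\<close>, the bound at \<open>v\<close> is at most the
  cost of every walk to \<open>v\<close> with at most \<open>k\<close> arcs more than a lightest one: only arcs that do not
  ascend a level use up slack, and those that do ascend are relaxed earlier in the same pass.
\<close>

section \<open>Hop distance\<close>

context wf_digraph
begin

lemma awalk_snoc_iff:
  "awalk u (p @ [e]) v \<longleftrightarrow> awalk u p (tail G e) \<and> e \<in> arcs G \<and> head G e = v"
  by (auto simp: awalk_def)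

text \<open>Meaningful only if \<open>v\<close> is reachable from \<open>u\<close>; otherwise no
  \<open>k\<close> qualifies and the value is unspecified.\<close>

definition hops :: "'a \<Rightarrow> 'a \<Rightarrow> nat" where
  "hops u v = (LEAST k. \<exists>p. awalk u p v \<and> length p = k)"

lemma hops_le: "awalk u p v \<Longrightarrow> hops u v \<le> length p"
  unfolding hops_def by (rule Least_le) blast

lemma hops_attained:
  assumes "u \<rightarrow>\<^sup>* v"
  obtains p where "awalk u p v" "length p = hops u v"
proof -
  have "\<exists>k p. awalk u p v \<and> length p = k"
    using assms by (auto simp: reachable_awalk)
  then have "\<exists>p. awalk u p v \<and> length p = hops u v"
    unfolding hops_def by (rule LeastI_ex)
  then show ?thesis
    using that by blast
qed

lemma hops_head_le:
  assumes "u \<rightarrow>\<^sup>* tail G e" "e \<in> arcs G"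
  shows "hops u (head G e) \<le> Suc (hops u (tail G e))"
proof -
  obtain p where p: "awalk u p (tail G e)" "length p = hops u (tail G e)"
    using assms(1) by (rule hops_attained)
  then have "awalk u (p @ [e]) (head G e)"
    using assms(2) by (simp only: awalk_snoc_iff)
  from hops_le[OF this] p show ?thesis by simp
qed

text \<open>Drop the last arc \<open>e\<close> of a walk with fewest arcs. The remaining prefix
  bounds the hop count of \<open>tail G e\<close> from above, and \<open>hops_head_le\<close> bounds
  it from below.\<close>

lemma hops_pred:
  assumes "u \<rightarrow>\<^sup>* v" "v \<noteq> u"
  obtains e where "e \<in> arcs G" "head G e = v" "u \<rightarrow>\<^sup>* tail G e"
    "hops u v = Suc (hops u (tail G e))"
proof -
  obtain p where p: "awalk u p v" "length p = hops u v"
    using assms(1) by (rule hops_attained)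
  with assms(2) have "p \<noteq> []"
    by (auto simp: awalk_simps)
  then obtain q e where "p = q @ [e]"
    by (metis rev_exhaust)
  then have q: "awalk u q (tail G e)" and e: "e \<in> arcs G" "head G e = v"
    using p(1) by (simp_all only: awalk_snoc_iff)
  have "u \<rightarrow>\<^sup>* tail G e"
    using q by (rule reachable_awalkI)
  moreover from this have "hops u v = Suc (hops u (tail G e))"
    using hops_le[OF q] hops_head_le[of u e] p(2) e \<open>p = q @ [e]\<close> by simp
  ultimately show ?thesis
    using e that by blast
qed

text \<open>Lightest walks to \<open>v\<close> exist as soon as any walk does, and all of them have
  \<open>hops u v\<close> arcs. This turns the existential in \<open>plus_light\<close> into a bound
  on the arc count.\<close>

lemma plus_light_iff: "plus_light t u p v \<longleftrightarrow> awalk u p v \<and> length p \<le> hops u v + t"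
proof -
  have "length q = hops u v" if "lightest u q v" for q
  proof -
    have "u \<rightarrow>\<^sup>* v"
      using that by (auto simp: lightest_def intro: reachable_awalkI)
    then obtain p where "awalk u p v" "length p = hops u v"
      by (rule hops_attained)
    then show ?thesis
      using that hops_le[of u q v] by (auto simp: lightest_def intro: le_antisym)
  qed
  moreover have "\<exists>q. lightest u q v" if "awalk u p v"
  proof -
    have "u \<rightarrow>\<^sup>* v"
      using that by (rule reachable_awalkI)
    then obtain q where "awalk u q v" "length q = hops u v"
      by (rule hops_attained)
    then have "lightest u q v"
      unfolding lightest_def by (metis hops_le)
    then show ?thesis ..
  qed
  ultimately show ?thesis
    unfolding plus_light_def by force
qed

section \<open>Breadth-first search order\<close>

text \<open>\<open>Q\<close> keeps every discovered vertex, including the first \<open>h\<close>,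
  which are already expanded. The conjunct for \<open>h < length Q\<close> pins the level of the
  next vertex to be appended, which is what keeps \<open>Q\<close> sorted.\<close>

definition bfs_inv :: "'a \<Rightarrow> 'a list \<Rightarrow> nat \<Rightarrow> bool" where
  "bfs_inv s Q h \<longleftrightarrow> h \<le> length Q \<and> s \<in> set Q \<and> distinct Q \<and> (\<forall>v \<in> set Q. s \<rightarrow>\<^sup>* v) \<and>
     sorted (map (hops s) Q) \<and> (\<forall>i<h. \<forall>e \<in> out_arcs G (Q ! i). head G e \<in> set Q) \<and>
     (h < length Q \<longrightarrow>
        (\<forall>v \<in> set Q. hops s v \<le> Suc (hops s (Q ! h))) \<and>
        (\<forall>v. s \<rightarrow>\<^sup>* v \<longrightarrow> hops s v \<le> hops s (Q ! h) \<longrightarrow> v \<in> set Q))"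

lemma hops_self: "s \<in> verts G \<Longrightarrow> hops s s = 0"
  using hops_le[of s "[]" s] by (simp add: awalk_simps)

lemma bfs_inv_init:
  assumes "s \<in> verts G"
  shows "bfs_inv s [s] 0"
proof -
  have "v = s" if "s \<rightarrow>\<^sup>* v" "hops s v \<le> 0" for v
    using that by (metis hops_pred le_zero_eq nat.distinct(1))
  then show ?thesis
    using assms hops_self[OF assms] by (simp add: bfs_inv_def)
qed

text \<open>The new vertex is exactly one level beyond \<open>Q ! h\<close>: the arc gives the upper
  bound, and a lower level would mean that it had been discovered already. No vertex of
  \<open>Q\<close> is on a higher level, so appending it preserves the order.\<close>

lemma bfs_inv_add:
  assumes inv: "bfs_inv s Q h" and h: "h < length Q"
    and e: "e \<in> arcs G" "tail G e = Q ! h" "head G e \<notin> set Q"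
  shows "bfs_inv s (Q @ [head G e]) h"
proof -
  have r: "s \<rightarrow>\<^sup>* tail G e"
    using inv h e by (auto simp: bfs_inv_def)
  then have r': "s \<rightarrow>\<^sup>* head G e"
    using e(1) by (meson in_arcs_imp_in_arcs_ends reachable_adj_trans)
  have "hops s (head G e) = Suc (hops s (Q ! h))"
  proof (rule antisym)
    show "hops s (head G e) \<le> Suc (hops s (Q ! h))"
      using hops_head_le[OF r e(1)] e(2) by simp
    show "Suc (hops s (Q ! h)) \<le> hops s (head G e)"
      using inv h r' e(3) unfolding bfs_inv_def by (meson not_less_eq_eq)
  qed
  then show ?thesis
    using inv h e r' by (simp add: bfs_inv_def sorted_append nth_append)
qed

text \<open>The delicate point is that the level of \<open>Q ! Suc h\<close> is fully discovered. If
  it is a new level, a vertex \<open>v\<close> on it has a predecessor on the level of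
  \<open>Q ! h\<close>, whose out-arcs have all been scanned.\<close>

lemma bfs_inv_next:
  assumes inv: "bfs_inv s Q h" and h: "h < length Q"
    and out: "\<forall>e \<in> out_arcs G (Q ! h). head G e \<in> set Q"
  shows "bfs_inv s Q (Suc h)"
proof -
  have closed: "\<forall>i<Suc h. \<forall>e \<in> out_arcs G (Q ! i). head G e \<in> set Q"
    using inv out by (auto simp: bfs_inv_def less_Suc_eq)
  have sorted: "hops s (Q ! i) \<le> hops s (Q ! j)" if "i \<le> j" "j < length Q" for i j
    using inv that sorted_nth_mono[of "map (hops s) Q" i j] by (simp add: bfs_inv_def)
  have "v \<in> set Q"
    if Suc: "Suc h < length Q" and v: "s \<rightarrow>\<^sup>* v" "hops s v \<le> hops s (Q ! Suc h)" for v
  proof (cases "hops s v \<le> hops s (Q ! h)")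
    case True
    then show ?thesis using inv h v by (simp add: bfs_inv_def)
  next
    case False
    have "hops s (Q ! Suc h) \<le> Suc (hops s (Q ! h))"
      using inv Suc by (simp add: bfs_inv_def)
    with False v have lvl: "hops s v = Suc (hops s (Q ! h))" "hops s (Q ! Suc h) = hops s v"
      by auto
    show ?thesis
    proof (cases "v = s")
      case True
      then show ?thesis using inv by (simp add: bfs_inv_def)
    next
      case False
      then obtain e where e: "e \<in> arcs G" "head G e = v" "s \<rightarrow>\<^sup>* tail G e"
        "hops s v = Suc (hops s (tail G e))"
        using hops_pred[OF v(1)] by blast
      then have "tail G e \<in> set Q"
        using inv h lvl by (simp add: bfs_inv_def)
      then obtain i where i: "i < length Q" "tail G e = Q ! i"
        by (metis in_set_conv_nth)
      \<comment> \<open>An index beyond \<open>h\<close> would put \<open>tail G e\<close> on the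
        level of \<open>Q ! Suc h\<close> or higher, but it is one level below.\<close>
      then have "i \<le> h"
        using sorted[of "Suc h" i] e lvl by (cases "i \<le> h") auto
      then show ?thesis
        using closed e i by (auto simp: less_Suc_eq_le)
    qed
  qed
  moreover have "hops s v \<le> Suc (hops s (Q ! Suc h))" if "Suc h < length Q" "v \<in> set Q" for v
    using inv that sorted[of h "Suc h"] by (fastforce simp: bfs_inv_def)
  ultimately show ?thesis
    using inv Suc_leI[OF h] closed unfolding bfs_inv_def by blast
qed

text \<open>With the whole queue expanded, \<open>set Q\<close> contains \<open>s\<close> and is
  closed under arcs, so it absorbs every walk from \<open>s\<close>.\<close>

lemma bfs_inv_complete:
  assumes "bfs_inv s Q (length Q)" "s \<rightarrow>\<^sup>* v"
  shows "v \<in> set Q"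
proof -
  have "v \<in> set Q" if "awalk s p v" for p
    using that
  proof (induction p arbitrary: v rule: rev_induct)
    case Nil
    then show ?case using assms(1) by (auto simp: awalk_simps bfs_inv_def)
  next
    case (snoc e p)
    then have "tail G e \<in> set Q" "e \<in> arcs G" "head G e = v"
      by (simp_all only: awalk_snoc_iff)
    then show ?case
      using assms(1) by (force simp: bfs_inv_def in_set_conv_nth)
  qed
  then show ?thesis
    using assms(2) by (auto simp: reachable_awalk)
qed

text \<open>Arcs of one block share their tail, so any enumeration \<open>out\<close> of the
  out-arcs serves; between blocks the order is that of \<open>Q\<close>.\<close>

lemma sorted_wrt_hops_concat:
  assumes "sorted (map (hops s) Q)" "\<And>u. set (out u) = out_arcs G u"
  shows "sorted_wrt (\<lambda>a b. hops s (tail G a) \<le> hops s (tail G b)) (concat (map out Q))"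
  using assms(1)
proof (induction Q)
  case (Cons u Q)
  have "sorted_wrt (\<lambda>a b. hops s (tail G a) \<le> hops s (tail G b)) (out u)"
    unfolding sorted_wrt_iff_nth_less
    using assms(2)[of u] by (metis in_out_arcs_conv nth_mem order.strict_trans order_refl)
  with Cons show ?case
    by (auto simp: sorted_wrt_append assms(2))
qed simp

section \<open>Relaxation passes\<close>

definition relax :: "'b weight_fun \<Rightarrow> 'b \<Rightarrow> ('a \<Rightarrow> real) \<Rightarrow> 'a \<Rightarrow> real" where
  "relax w e d =
     (if d (tail G e) + w e < d (head G e) then d(head G e := d (tail G e) + w e) else d)"

text \<open>The soundness invariant: the cost of an actual walk is never below the distance. It is
  restricted to \<open>V\<close> because \<open>d\<close> is real-valued and may hold arbitrary
  memory contents at undiscovered vertices.\<close>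

definition walk_costs :: "'b weight_fun \<Rightarrow> 'a \<Rightarrow> ('a \<Rightarrow> real) \<Rightarrow> 'a set \<Rightarrow> bool" where
  "walk_costs w s d V \<longleftrightarrow> (\<forall>v \<in> V. \<exists>p. awalk s p v \<and> awalk_cost w p = d v)"

text \<open>Append \<open>e\<close> to the walk behind \<open>d (tail G e)\<close>. This justifies
  both a relaxation and the first bound of a newly discovered vertex.\<close>

lemma walk_costs_arc:
  assumes "walk_costs w s d V" "e \<in> arcs G" "tail G e \<in> V"
  shows "\<exists>p. awalk s p (head G e) \<and> awalk_cost w p = d (tail G e) + w e"
proof -
  obtain p where "awalk s p (tail G e)" "awalk_cost w p = d (tail G e)"
    using assms by (auto simp: walk_costs_def)
  then have "awalk s (p @ [e]) (head G e) \<and> awalk_cost w (p @ [e]) = d (tail G e) + w e"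
    using assms(2) by (simp add: awalk_snoc_iff del: awalk_append_iff)
  then show ?thesis by blast
qed

lemma walk_costs_relax:
  assumes "walk_costs w s d V" "e \<in> arcs G" "tail G e \<in> V"
  shows "walk_costs w s (relax w e d) V"
  using assms(1) walk_costs_arc[OF assms] by (simp add: walk_costs_def relax_def)

lemma walk_costs_fold:
  assumes "walk_costs w s d V" "\<forall>e \<in> set es. e \<in> arcs G \<and> tail G e \<in> V"
  shows "walk_costs w s (fold (relax w) es d) V"
  using assms by (induction es arbitrary: d) (simp_all add: walk_costs_relax)

lemma walk_costs_passes:
  assumes "walk_costs w s d V" "\<forall>e \<in> set es. e \<in> arcs G \<and> tail G e \<in> V"
  shows "walk_costs w s ((fold (relax w) es ^^ k) d) V"
  by (induction k) (simp_all add: assms walk_costs_fold)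

lemma fold_relax_le: "fold (relax w) es d v \<le> d v"
proof (induction es arbitrary: d)
  case (Cons e es)
  have "relax w e d v \<le> d v"
    by (simp add: relax_def)
  with Cons[of "relax w e d"] show ?case by simp
qed simp

lemma relax_passes_antimono:
  assumes "j \<le> k"
  shows "(fold (relax w) es ^^ k) d v \<le> (fold (relax w) es ^^ j) d v"
  using assms
proof (induction rule: dec_induct)
  case (step n)
  then show ?case
    using fold_relax_le[of w es "(fold (relax w) es ^^ n) d" v] by simp
qed simp

text \<open>
  A walk to \<open>v\<close> with at most \<open>hops s v + k\<close> arcs that ends in an arc from \<open>u\<close> has a prefix to \<open>u\<close>
  with at most \<open>hops s u + k'\<close> arcs, where either \<open>k' < k\<close>, or \<open>k' = k\<close> and \<open>u\<close> is on an earlier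
  level than \<open>v\<close>. So the last arc has been relaxed after \<open>u\<close> was settled for \<open>k'\<close> and before the
  arcs out of \<open>v\<close> are reached in pass \<open>k\<close>.
\<close>

lemma relax_passes_upto:
  assumes sorted: "sorted_wrt (\<lambda>a b. hops s (tail G a) \<le> hops s (tail G b)) es"
    and complete: "\<And>e. e \<in> arcs G \<Longrightarrow> s \<rightarrow>\<^sup>* tail G e \<Longrightarrow> e \<in> set es"
    and source: "d s \<le> 0"
    and "awalk s p v" "length p \<le> hops s v + k"
    and "es = pre @ post" "\<forall>e \<in> set post. hops s v \<le> hops s (tail G e)"
  shows "fold (relax w) pre ((fold (relax w) es ^^ k) d) v \<le> awalk_cost w p"
  using assms(4-7)
proof (induction p arbitrary: v k pre post rule: rev_induct)
  case Nil
  then have "v = s"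
    by (simp add: awalk_simps)
  then show ?case
    using source fold_relax_le[of w pre "(fold (relax w) es ^^ k) d" s]
      relax_passes_antimono[of 0 k w es d s] by simp
next
  case (snoc e p)
  let ?d = "\<lambda>k. (fold (relax w) es ^^ k) d"
  have p: "awalk s p (tail G e)" and e: "e \<in> arcs G" and v: "head G e = v"
    using snoc.prems(1) by (simp_all only: awalk_snoc_iff)
  have r: "s \<rightarrow>\<^sup>* tail G e"
    using p by (rule reachable_awalkI)
  \<comment> \<open>The slack of the prefix; the subtraction does not truncate, by
    \<open>hops_le\<close>.\<close>
  define j where "j = length p - hops s (tail G e)"
  have j: "length p = hops s (tail G e) + j"
    using hops_le[OF p] by (simp add: j_def)
  have "j \<le> k"
    using j snoc.prems(2) hops_head_le[OF r e] v by simp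
  have step: "fold (relax w) (ys @ [e]) (?d j) v \<le> awalk_cost w (p @ [e])"
    if split: "es = ys @ e # zs" for ys zs
  proof -
    \<comment> \<open>By sortedness, \<open>ys\<close> and \<open>e # zs\<close> form an admissible
      split for the vertex \<open>tail G e\<close>, so the induction hypothesis applies just before
      \<open>e\<close> is relaxed.\<close>
    have "\<forall>a \<in> set (e # zs). hops s (tail G e) \<le> hops s (tail G a)"
      using sorted unfolding split sorted_wrt_append by auto
    then have "fold (relax w) ys (?d j) (tail G e) \<le> awalk_cost w p"
      using snoc.IH[OF p _ split] j by simp
    then show ?thesis
      using v by (auto simp: relax_def)
  qed
  have mem: "e \<in> set es"
    using complete[OF e r] .
  show ?case
  proof (cases "j < k")
    case True
    obtain ys zs where split: "es = ys @ e # zs"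
      using mem by (metis split_list)
    \<comment> \<open>Pass \<open>j\<close> is complete before pass \<open>k\<close> starts. Once it
      has relaxed \<open>e\<close>, all further relaxations can only lower the bound.\<close>
    have "fold (relax w) pre (?d k) v \<le> ?d k v"
      by (rule fold_relax_le)
    also have "\<dots> \<le> ?d (Suc j) v"
      using True by (intro relax_passes_antimono) simp
    also have "?d (Suc j) = fold (relax w) es (?d j)"
      by simp
    also have "\<dots> = fold (relax w) zs (fold (relax w) (ys @ [e]) (?d j))"
      by (subst split) simp
    also have "\<dots> v \<le> fold (relax w) (ys @ [e]) (?d j) v"
      by (rule fold_relax_le)
    also have "\<dots> \<le> awalk_cost w (p @ [e])"
      using split by (rule step)
    finally show ?thesis .
  next
    case False
    with \<open>j \<le> k\<close> have "j = k" by simp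
    \<comment> \<open>The prefix already has slack \<open>k\<close>, so the last arc must ascend a
      level.\<close>
    then have "hops s (tail G e) < hops s v"
      using j snoc.prems(2) by simp
    then have "e \<notin> set post"
      using snoc.prems(4) by auto
    then have "e \<in> set pre"
      using mem snoc.prems(3) by simp
    then obtain ys zs where split: "pre = ys @ e # zs"
      by (metis split_list)
    have "fold (relax w) pre (?d k) v \<le> fold (relax w) (ys @ [e]) (?d k) v"
      using fold_relax_le[of w zs "fold (relax w) (ys @ [e]) (?d k)" v] by (simp add: split)
    also have "\<dots> \<le> awalk_cost w (p @ [e])"
      using step[of ys "zs @ post"] \<open>j = k\<close> snoc.prems(3) split by simp
    finally show ?thesis .
  qed
qed

text \<open>Take the moment at the end of pass \<open>t\<close>: \<open>pre\<close> is all of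
  \<open>es\<close> and \<open>post\<close> is empty. Counting from 0, this is after
  \<open>t + 1\<close> passes.\<close>

lemma relax_passes_plus_light:
  assumes "sorted_wrt (\<lambda>a b. hops s (tail G a) \<le> hops s (tail G b)) es"
    and "\<And>e. e \<in> arcs G \<Longrightarrow> s \<rightarrow>\<^sup>* tail G e \<Longrightarrow> e \<in> set es"
    and "d s \<le> 0" "plus_light t s p v"
  shows "(fold (relax w) es ^^ (t + 1)) d v \<le> awalk_cost w p"
  using relax_passes_upto[where s = s and d = d and pre = es and post = "[]", OF assms(1-3)] assms(4)
  by (simp add: plus_light_iff)

end

section \<open>Weakest preconditions with running time\<close>

definition wp :: "com \<Rightarrow> (nat \<Rightarrow> state \<Rightarrow> bool) \<Rightarrow> state \<Rightarrow> bool" where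
  "wp c Q \<sigma> \<longleftrightarrow> (\<exists>T \<sigma>'. exec c \<sigma> T \<sigma>' \<and> Q T \<sigma>')"

lemma wp_mono:
  assumes "wp c Q \<sigma>" "\<And>T \<sigma>'. Q T \<sigma>' \<Longrightarrow> Q' T \<sigma>'"
  shows "wp c Q' \<sigma>"
  using assms unfolding wp_def by blast

lemma wp_simps [simp]:
  "wp Skip Q \<sigma> \<longleftrightarrow> Q 1 \<sigma>"
  "wp (NSet x e) Q \<sigma> \<longleftrightarrow> Q (ncost e + 1) (\<sigma>\<lparr>nreg := (nreg \<sigma>)(x := nval e \<sigma>)\<rparr>)"
  "wp (NPut x i e) Q \<sigma> \<longleftrightarrow> Q (ncost i + ncost e + 1)
     (\<sigma>\<lparr>narr := (narr \<sigma>)(x := (narr \<sigma> x)(nval i \<sigma> := nval e \<sigma>))\<rparr>)"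
  "wp (RSet x r) Q \<sigma> \<longleftrightarrow> Q (rcost r + 1) (\<sigma>\<lparr>rreg := (rreg \<sigma>)(x := rval r \<sigma>)\<rparr>)"
  "wp (RPut x i r) Q \<sigma> \<longleftrightarrow> Q (ncost i + rcost r + 1)
     (\<sigma>\<lparr>rarr := (rarr \<sigma>)(x := (rarr \<sigma> x)(nval i \<sigma> := rval r \<sigma>))\<rparr>)"
  "wp (Seq c d) Q \<sigma> \<longleftrightarrow> wp c (\<lambda>T. wp d (\<lambda>T'. Q (T + T'))) \<sigma>"
  unfolding wp_def
  by (fastforce elim: exec_SkipE exec_NSetE exec_NPutE exec_RSetE exec_RPutE exec_SeqE
      intro: exec.intros)+

lemma wp_Cond [simp]:
  "wp (Cond b c d) Q \<sigma> \<longleftrightarrow>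
     (if bval b \<sigma> then wp c (\<lambda>T. Q (bcost b + T + 1)) \<sigma> else wp d (\<lambda>T. Q (bcost b + T + 1)) \<sigma>)"
  unfolding wp_def by (auto elim!: exec_CondE intro: exec.intros) (metis CondTrue CondFalse Suc_eq_plus1)+

text \<open>\<open>\<Phi>\<close> is a time budget. Each iteration pays for guard, body and overhead
  out of its decrease, which is therefore strict and forces termination; the extra
  \<open>bcost b + 1\<close> is the final failed test. The leftover \<open>\<Phi> \<sigma>'\<close>
  is kept in \<open>exit\<close> so that nested loops can be charged amortised.\<close>

lemma wp_While:
  fixes \<Phi> :: "state \<Rightarrow> nat"
  assumes "I \<sigma>"
    and step: "\<And>\<sigma>. I \<sigma> \<Longrightarrow> bval b \<sigma> \<Longrightarrow>
      wp c (\<lambda>T \<sigma>'. I \<sigma>' \<and> bcost b + T + 1 + \<Phi> \<sigma>' \<le> \<Phi> \<sigma>) \<sigma>"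
    and exit: "\<And>T \<sigma>'. I \<sigma>' \<Longrightarrow> \<not> bval b \<sigma>' \<Longrightarrow> T + \<Phi> \<sigma>' \<le> \<Phi> \<sigma> + bcost b + 1 \<Longrightarrow> Q T \<sigma>'"
  shows "wp (While b c) Q \<sigma>"
proof -
  have "\<exists>T \<sigma>'. exec (While b c) \<sigma> T \<sigma>' \<and> I \<sigma>' \<and> \<not> bval b \<sigma>' \<and>
    T + \<Phi> \<sigma>' \<le> \<Phi> \<sigma> + bcost b + 1"
    using \<open>I \<sigma>\<close>
  proof (induction "\<Phi> \<sigma>" arbitrary: \<sigma> rule: less_induct)
    case less
    show ?case
    proof (cases "bval b \<sigma>")
      case True
      obtain T \<sigma>1 where 1: "exec c \<sigma> T \<sigma>1" "I \<sigma>1" "bcost b + T + 1 + \<Phi> \<sigma>1 \<le> \<Phi> \<sigma>"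
        using step[OF less.prems True] unfolding wp_def by blast
      then obtain T' \<sigma>2 where "exec (While b c) \<sigma>1 T' \<sigma>2" "I \<sigma>2" "\<not> bval b \<sigma>2"
        "T' + \<Phi> \<sigma>2 \<le> \<Phi> \<sigma>1 + bcost b + 1"
        using less.hyps[of \<sigma>1] by auto
      with 1 show ?thesis
        using WhileTrue[OF True 1(1)] by (intro exI[of _ "bcost b + T + T' + 1"] exI[of _ \<sigma>2]) simp
    next
      case False
      then show ?thesis
        using less.prems WhileFalse by fastforce
    qed
  qed
  then show ?thesis
    using exit unfolding wp_def by blast
qed

text \<open>Index \<open>e\<close> is stored as \<open>e + 1\<close>, so that \<open>0\<close> can mark the end of a linked list.\<close>

primrec chain :: "(nat \<Rightarrow> nat) \<Rightarrow> nat \<Rightarrow> nat list \<Rightarrow> bool" where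
  "chain nxt a [] \<longleftrightarrow> a = 0"
| "chain nxt a (e # es) \<longleftrightarrow> a = Suc e \<and> chain nxt (nxt e) es"

lemma chain_upd [simp]: "e \<notin> set es \<Longrightarrow> chain (nxt(e := y)) a es \<longleftrightarrow> chain nxt a es"
  by (induction es arbitrary: a) auto

lemma chain_0 [simp]: "chain nxt 0 es \<longleftrightarrow> es = []"
  by (cases es) auto

section \<open>The program\<close>

abbreviation incr :: "vname \<Rightarrow> com" where
  "incr x \<equiv> NSet x (NAdd (NReg x) (NConst 1))"

abbreviation arc_tail :: "vname \<Rightarrow> nexp" where
  "arc_tail x \<equiv> NArr ''tail'' (NReg x)"

abbreviation arc_head :: "vname \<Rightarrow> nexp" where
  "arc_head x \<equiv> NArr ''head'' (NReg x)"

abbreviation relax_value :: "vname \<Rightarrow> rexp" where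
  "relax_value x \<equiv> RAdd (RArr ''bound'' (arc_tail x)) (RArr ''weight'' (NReg x))"

text \<open>Memory starts with arbitrary contents, so the list heads and discovery flags have to be
  zeroed.\<close>

definition clear_prog :: com where
  "clear_prog =
     Seq (NSet ''i'' (NConst 0))
     (While (NLess (NReg ''i'') (NReg ''n''))
       (Seq (NPut ''first'' (NReg ''i'') (NConst 0))
       (Seq (NPut ''finite'' (NReg ''i'') (NConst 0))
       (incr ''i''))))"

text \<open>Builds adjacency lists from the unsorted arc list in linear time, prepending each arc to
  the list of its tail: \<open>first\<close> holds the list heads, \<open>next\<close> the
  links.\<close>

definition link_prog :: com where
  "link_prog =
     Seq (NSet ''i'' (NConst 0))
     (While (NLess (NReg ''i'') (NReg ''m''))
       (Seq (NPut ''next'' (NReg ''i'') (NArr ''first'' (arc_tail ''i'')))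
       (Seq (NPut ''first'' (arc_tail ''i'') (NAdd (NReg ''i'') (NConst 1)))
       (incr ''i''))))"

text \<open>The flag \<open>finite\<close> doubles as the mark of the vertices already discovered.\<close>

definition scan_arc_prog :: com where
  "scan_arc_prog =
     Seq (NSet ''e'' (NSub (NReg ''a'') (NConst 1)))
     (Seq (NPut ''order'' (NReg ''c'') (NReg ''e''))
     (Seq (incr ''c'')
     (Seq (NSet ''a'' (NArr ''next'' (NReg ''e'')))
     (Cond (NLess (NConst 0) (NArr ''finite'' (arc_head ''e'')))
       Skip
       (Seq (NPut ''finite'' (arc_head ''e'') (NConst 1))
       (Seq (RPut ''bound'' (arc_head ''e'') (relax_value ''e''))
       (Seq (NPut ''queue'' (NReg ''qt'') (arc_head ''e''))
       (incr ''qt''))))))))"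

definition bfs_prog :: com where
  "bfs_prog =
     Seq (NPut ''finite'' (NReg ''s'') (NConst 1))
     (Seq (RPut ''bound'' (NReg ''s'') RZero)
     (Seq (NPut ''queue'' (NConst 0) (NReg ''s''))
     (Seq (NSet ''qh'' (NConst 0))
     (Seq (NSet ''qt'' (NConst 1))
     (Seq (NSet ''c'' (NConst 0))
     (While (NLess (NReg ''qh'') (NReg ''qt''))
       (Seq (NSet ''a'' (NArr ''first'' (NArr ''queue'' (NReg ''qh''))))
       (Seq (While (NLess (NConst 0) (NReg ''a'')) scan_arc_prog)
       (incr ''qh'')))))))))"

definition pass_prog :: com where
  "pass_prog =
     While (NLess (NReg ''i'') (NReg ''c''))
       (Seq (NSet ''e'' (NArr ''order'' (NReg ''i'')))
       (Seq (Cond (RLess (relax_value ''e'') (RArr ''bound'' (arc_head ''e'')))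
         (RPut ''bound'' (arc_head ''e'') (relax_value ''e''))
         Skip)
       (incr ''i'')))"

definition relax_prog :: com where
  "relax_prog =
     Seq (NSet ''k'' (NConst 0))
     (While (NLess (NReg ''k'') (NAdd (NReg ''t'') (NConst 1)))
       (Seq (NSet ''i'' (NConst 0))
       (Seq pass_prog
       (incr ''k''))))"

definition plus_light_prog :: com where
  "plus_light_prog = Seq clear_prog (Seq link_prog (Seq bfs_prog relax_prog))"

section \<open>Correctness and running time\<close>

locale source_instance = wf_digraph G for G :: "(nat, nat) pre_digraph" (structure) +
  fixes w :: "nat weight_fun" and s t N M :: nat
  assumes verts_eq: "verts G = {..<N}" and arcs_eq: "arcs G = {..<M}" and source: "s < N"
begin

text \<open>The part of memory that no subprogram overwrites, expressed with fixed \<open>N\<close>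
  and \<open>M\<close> so that it can serve as an invariant of every loop.\<close>

definition input :: "state \<Rightarrow> bool" where
  "input \<sigma> \<longleftrightarrow> nreg \<sigma> ''n'' = N \<and> nreg \<sigma> ''m'' = M \<and> nreg \<sigma> ''s'' = s \<and> nreg \<sigma> ''t'' = t \<and>
     (\<forall>e<M. narr \<sigma> ''tail'' e = tail G e \<and> narr \<sigma> ''head'' e = head G e \<and>
        rarr \<sigma> ''weight'' e = w e)"

lemma input_if_encodes: "encodes \<sigma> G w s t \<Longrightarrow> input \<sigma>"
  unfolding encodes_def input_def verts_eq arcs_eq by auto

lemma ends_less: "e < M \<Longrightarrow> tail G e < N" "e < M \<Longrightarrow> head G e < N"
  using wellformed[of e] by (simp_all add: verts_eq arcs_eq)

text \<open>Reversed because \<open>link_prog\<close> prepends arcs in increasing order.\<close>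

definition out :: "nat \<Rightarrow> nat list" where
  "out u = rev (filter (\<lambda>e. tail G e = u) [0..<M])"

lemma set_out: "set (out u) = out_arcs G u"
  by (auto simp: out_def arcs_eq)

lemma distinct_out: "distinct (out u)"
  by (simp add: out_def)

lemma distinct_concat_out: "distinct Q \<Longrightarrow> distinct (concat (map out Q))"
  by (induction Q) (auto simp: distinct_out set_out)

text \<open>Every arc has a single tail, so it occurs at most once; this bounds the total scanning
  work of the search.\<close>

lemma length_concat_out_le:
  assumes "distinct Q"
  shows "length (concat (map out Q)) \<le> M"
proof -
  have "set (concat (map out Q)) \<subseteq> {..<M}"
    by (auto simp: set_out arcs_eq)
  from card_mono[OF _ this] show ?thesis
    using distinct_card[OF distinct_concat_out[OF assms]] by simp
qed

section \<open>Initialisation and adjacency lists\<close>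

lemma wp_clear:
  assumes "input \<sigma>"
    and post: "\<And>T \<sigma>'. T \<le> 20 * N + 6 \<Longrightarrow> input \<sigma>' \<Longrightarrow>
      \<forall>v<N. narr \<sigma>' ''first'' v = 0 \<and> narr \<sigma>' ''finite'' v = 0 \<Longrightarrow> Q T \<sigma>'"
  shows "wp clear_prog Q \<sigma>"
\<comment> \<open>An iteration costs 14 units, rounded up to 20. The additive 6 is the initial
  assignment (2) and the failed last test (4).\<close>
proof (simp add: clear_prog_def,
    rule wp_While[where \<Phi> = "\<lambda>\<tau>. 20 * (N - nreg \<tau> ''i'')" and
      I = "\<lambda>\<tau>. input \<tau> \<and> nreg \<tau> ''i'' \<le> N \<and>
        (\<forall>v<nreg \<tau> ''i''. narr \<tau> ''first'' v = 0 \<and> narr \<tau> ''finite'' v = 0)"],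
    goal_cases)
  case 1
  then show ?case using assms(1) by (simp add: input_def)
next
  case (2 \<tau>)
  then show ?case by (auto simp: input_def less_Suc_eq)
next
  case (3 T \<tau>)
  then show ?case by (intro post) (auto simp: input_def)
qed

definition linked :: "state \<Rightarrow> bool" where
  "linked \<sigma> \<longleftrightarrow> (\<forall>u<N. chain (narr \<sigma> ''next'') (narr \<sigma> ''first'' u) (out u))"

lemma wp_link:
  assumes "input \<sigma>" "\<forall>v<N. narr \<sigma> ''first'' v = 0 \<and> narr \<sigma> ''finite'' v = 0"
    and post: "\<And>T \<sigma>'. T \<le> 20 * M + 6 \<Longrightarrow> input \<sigma>' \<Longrightarrow> linked \<sigma>' \<Longrightarrow>
      \<forall>v<N. narr \<sigma>' ''finite'' v = 0 \<Longrightarrow> Q T \<sigma>'"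
  shows "wp link_prog Q \<sigma>"
proof (simp add: link_prog_def,
    rule wp_While[where \<Phi> = "\<lambda>\<tau>. 20 * (M - nreg \<tau> ''i'')" and
      I = "\<lambda>\<tau>. input \<tau> \<and> nreg \<tau> ''i'' \<le> M \<and> (\<forall>v<N. narr \<tau> ''finite'' v = 0) \<and>
        (\<forall>u<N. chain (narr \<tau> ''next'') (narr \<tau> ''first'' u)
          (rev (filter (\<lambda>e. tail G e = u) [0..<nreg \<tau> ''i''])))"],
    goal_cases)
  case 1
  then show ?case using assms(1,2) by (simp add: input_def)
next
  case (2 \<tau>)
  then show ?case by (auto simp: input_def)
next
  case (3 T \<tau>)
  then show ?case by (intro post) (auto simp: input_def linked_def out_def)
qed

section \<open>Arrays read as lists, and a single relaxation pass\<close>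

definition queue :: "state \<Rightarrow> nat list" where
  "queue \<sigma> = map (narr \<sigma> ''queue'') [0..<nreg \<sigma> ''qt'']"

definition order :: "state \<Rightarrow> nat list" where
  "order \<sigma> = map (narr \<sigma> ''order'') [0..<nreg \<sigma> ''c'']"

text \<open>The array \<open>bound\<close> agrees with the abstract fold at every index, discovered
  or not, so all reasoning about walks can be done on \<open>fold (relax w)\<close>.\<close>

lemma wp_pass:
  assumes "input \<sigma>" "nreg \<sigma> ''i'' = 0" "set (order \<sigma>) \<subseteq> arcs G"
    and post: "\<And>T \<sigma>'. T \<le> 40 * nreg \<sigma> ''c'' + 4 \<Longrightarrow> input \<sigma>' \<Longrightarrow> order \<sigma>' = order \<sigma> \<Longrightarrow>
      nreg \<sigma>' ''c'' = nreg \<sigma> ''c'' \<Longrightarrow> nreg \<sigma>' ''k'' = nreg \<sigma> ''k'' \<Longrightarrow>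
      narr \<sigma>' ''finite'' = narr \<sigma> ''finite'' \<Longrightarrow>
      rarr \<sigma>' ''bound'' = fold (relax w) (order \<sigma>) (rarr \<sigma> ''bound'') \<Longrightarrow> Q T \<sigma>'"
  shows "wp pass_prog Q \<sigma>"
  unfolding pass_prog_def
proof (rule wp_While[where \<Phi> = "\<lambda>\<tau>. 40 * (nreg \<sigma> ''c'' - nreg \<tau> ''i'')" and
      I = "\<lambda>\<tau>. input \<tau> \<and> nreg \<tau> ''i'' \<le> nreg \<tau> ''c'' \<and>
        nreg \<tau> ''c'' = nreg \<sigma> ''c'' \<and> nreg \<tau> ''k'' = nreg \<sigma> ''k'' \<and>
        narr \<tau> ''finite'' = narr \<sigma> ''finite'' \<and> narr \<tau> ''order'' = narr \<sigma> ''order'' \<and>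
        rarr \<tau> ''bound'' = fold (relax w) (take (nreg \<tau> ''i'') (order \<sigma>)) (rarr \<sigma> ''bound'')"],
      goal_cases)
  case 1
  then show ?case using assms(1,2) by simp
next
  case (2 \<tau>)
  let ?e = "narr \<sigma> ''order'' (nreg \<tau> ''i'')"
  have i: "nreg \<tau> ''i'' < nreg \<sigma> ''c''"
    using 2 by simp
  then have "?e < M"
    using assms(3) by (auto simp: order_def arcs_eq image_subset_iff)
  moreover have "take (Suc (nreg \<tau> ''i'')) (order \<sigma>) = take (nreg \<tau> ''i'') (order \<sigma>) @ [?e]"
    using i by (simp add: order_def take_Suc_conv_app_nth)
  ultimately show ?case
    using 2 i by (auto simp: input_def relax_def)
next
  case (3 T \<tau>)
  then show ?case by (intro post) (auto simp: order_def)
qed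

section \<open>The search loop\<close>

definition bfs_state :: "state \<Rightarrow> bool" where
  "bfs_state \<sigma> \<longleftrightarrow> input \<sigma> \<and> linked \<sigma> \<and>
     (\<forall>v<N. 0 < narr \<sigma> ''finite'' v \<longleftrightarrow> v \<in> set (queue \<sigma>)) \<and>
     walk_costs w s (rarr \<sigma> ''bound'') (set (queue \<sigma>)) \<and> rarr \<sigma> ''bound'' s = 0 \<and>
     bfs_inv s (queue \<sigma>) (nreg \<sigma> ''qh'')"

text \<open>
  The arcs \<open>ys\<close> out of the vertex at the queue's head have been scanned, the arcs \<open>xs\<close> are
  still to come.
\<close>

definition scanning :: "state \<Rightarrow> nat list \<Rightarrow> nat list \<Rightarrow> bool" where
  "scanning \<sigma> ys xs \<longleftrightarrow> bfs_state \<sigma> \<and> nreg \<sigma> ''qh'' < nreg \<sigma> ''qt'' \<and>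
     out (queue \<sigma> ! nreg \<sigma> ''qh'') = ys @ xs \<and>
     chain (narr \<sigma> ''next'') (nreg \<sigma> ''a'') xs \<and>
     order \<sigma> = concat (map out (take (nreg \<sigma> ''qh'') (queue \<sigma>))) @ ys \<and>
     (\<forall>e \<in> set ys. head G e \<in> set (queue \<sigma>))"

lemma length_queue [simp]: "length (queue \<sigma>) = nreg \<sigma> ''qt''"
  by (simp add: queue_def)

lemma length_order [simp]: "length (order \<sigma>) = nreg \<sigma> ''c''"
  by (simp add: order_def)

lemma bfs_inv_length_le:
  assumes "bfs_inv s Q h"
  shows "length Q \<le> N"
proof -
  have "set Q \<subseteq> {..<N}"
    using assms reachable_in_verts(2) by (fastforce simp: bfs_inv_def verts_eq)
  moreover have "distinct Q"
    using assms by (simp add: bfs_inv_def)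
  ultimately show ?thesis
    using card_mono[of "{..<N}" "set Q"] by (simp add: distinct_card)
qed

text \<open>The recorded arcs followed by \<open>e # xs\<close> are the out-arcs of distinct
  vertices, hence at most \<open>M\<close> in number. So the budget \<open>M - c\<close> really
  drops when \<open>e\<close> is recorded.\<close>

lemma scanning_less:
  assumes "scanning \<sigma> ys (e # xs)"
  shows "nreg \<sigma> ''c'' < M"
proof -
  let ?Q = "queue \<sigma>" and ?h = "nreg \<sigma> ''qh''"
  have "distinct (take (Suc ?h) ?Q)"
    using assms by (simp add: scanning_def bfs_state_def bfs_inv_def)
  from length_concat_out_le[OF this]
  have "length (order \<sigma> @ e # xs) \<le> M"
    using assms by (simp add: scanning_def take_Suc_conv_app_nth)
  then show ?thesis by simp
qed

lemma wp_scan_arc: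
  assumes sc: "scanning \<sigma> ys (e # xs)"
  shows "wp scan_arc_prog (\<lambda>T \<sigma>'. scanning \<sigma>' (ys @ [e]) xs \<and> T \<le> 60 \<and>
    nreg \<sigma>' ''c'' = Suc (nreg \<sigma> ''c'') \<and> nreg \<sigma>' ''qh'' = nreg \<sigma> ''qh'') \<sigma>"
proof -
  let ?Q = "queue \<sigma>" and ?h = "nreg \<sigma> ''qh''"
  have a: "nreg \<sigma> ''a'' = Suc e" and inp: "input \<sigma>" and h: "?h < length ?Q"
    and inv: "bfs_inv s ?Q ?h"
    using sc by (simp_all add: scanning_def bfs_state_def)
  have "e \<in> set (out (?Q ! ?h))"
    using sc by (simp add: scanning_def)
  then have e: "e \<in> arcs G" "e < M" "tail G e = ?Q ! ?h"
    by (simp_all add: set_out arcs_eq)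
  then have mem: "narr \<sigma> ''tail'' e = tail G e" "narr \<sigma> ''head'' e = head G e"
    "rarr \<sigma> ''weight'' e = w e"
    using inp by (simp_all add: input_def)
  have finite: "0 < narr \<sigma> ''finite'' (head G e) \<longleftrightarrow> head G e \<in> set ?Q"
    using sc ends_less(2)[OF e(2)] by (simp add: scanning_def bfs_state_def)
  show ?thesis
  proof (cases "head G e \<in> set ?Q")
    case True
    then have fin: "0 < narr \<sigma> ''finite'' (head G e)"
      using finite by simp
    \<comment> \<open>The final state is written out explicitly, which separates executing the
      program from re-establishing the invariant.\<close>
    define \<tau> where "\<tau> = \<sigma>\<lparr>
      nreg := (nreg \<sigma>)(''e'' := e, ''c'' := Suc (nreg \<sigma> ''c''), ''a'' := narr \<sigma> ''next'' e),
      narr := (narr \<sigma>)(''order'' := (narr \<sigma> ''order'')(nreg \<sigma> ''c'' := e))\<rparr>"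
    have [simp]: "queue \<tau> = ?Q" "order \<tau> = order \<sigma> @ [e]"
      by (simp_all add: \<tau>_def queue_def order_def)
    have "bfs_state \<tau>"
      using sc by (simp add: scanning_def bfs_state_def input_def linked_def) (simp add: \<tau>_def)
    then have "scanning \<tau> (ys @ [e]) xs"
      using sc h True by (simp add: scanning_def) (simp add: \<tau>_def)
    moreover have "wp scan_arc_prog (\<lambda>T \<sigma>'. \<sigma>' = \<tau> \<and> T \<le> 60) \<sigma>"
      using fin a mem by (simp add: scan_arc_prog_def \<tau>_def)
    ultimately show ?thesis
      by (elim wp_mono) (simp add: \<tau>_def)
  next
    case False
    then have fin: "narr \<sigma> ''finite'' (head G e) = 0"
      using finite by simp
    have inv': "bfs_inv s (?Q @ [head G e]) ?h"
      using bfs_inv_add[OF inv h] e False by simp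
    \<comment> \<open>The source is in the queue from the start, so its bound 0 is never overwritten
      here.\<close>
    have "s \<noteq> head G e"
      using inv False by (auto simp: bfs_inv_def)
    have costs: "walk_costs w s (rarr \<sigma> ''bound'') (set ?Q)"
      using sc by (simp add: scanning_def bfs_state_def)
    have costs': "walk_costs w s ((rarr \<sigma> ''bound'')(head G e := rarr \<sigma> ''bound'' (tail G e) + w e))
        (insert (head G e) (set ?Q))"
      using costs False walk_costs_arc[OF costs e(1)] e(3) h by (simp add: walk_costs_def)
    define \<tau> where "\<tau> = \<sigma>\<lparr>
      nreg := (nreg \<sigma>)(''e'' := e, ''c'' := Suc (nreg \<sigma> ''c''),
        ''a'' := narr \<sigma> ''next'' e, ''qt'' := Suc (nreg \<sigma> ''qt'')),
      narr := (narr \<sigma>)(''order'' := (narr \<sigma> ''order'')(nreg \<sigma> ''c'' := e),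
        ''finite'' := (narr \<sigma> ''finite'')(head G e := 1),
        ''queue'' := (narr \<sigma> ''queue'')(nreg \<sigma> ''qt'' := head G e)),
      rarr := (rarr \<sigma>)(''bound'' :=
        (rarr \<sigma> ''bound'')(head G e := rarr \<sigma> ''bound'' (tail G e) + w e))\<rparr>"
    have [simp]: "queue \<tau> = ?Q @ [head G e]" "order \<tau> = order \<sigma> @ [e]"
      by (simp_all add: \<tau>_def queue_def order_def)
    have [simp]: "nreg \<tau> ''qh'' = ?h" "nreg \<tau> ''qt'' = Suc (nreg \<sigma> ''qt'')"
      "nreg \<tau> ''a'' = narr \<sigma> ''next'' e" "narr \<tau> ''next'' = narr \<sigma> ''next''"
      "narr \<tau> ''finite'' = (narr \<sigma> ''finite'')(head G e := 1)"
      "rarr \<tau> ''bound'' = (rarr \<sigma> ''bound'')(head G e := rarr \<sigma> ''bound'' (tail G e) + w e)"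
      by (simp_all add: \<tau>_def)
    have "input \<tau>" "linked \<tau>"
      using sc by (simp_all add: scanning_def bfs_state_def input_def linked_def \<tau>_def)
    then have "bfs_state \<tau>"
      using sc inv' costs' \<open>s \<noteq> head G e\<close> by (simp add: scanning_def bfs_state_def)
    then have "scanning \<tau> (ys @ [e]) xs"
      using sc h by (simp add: scanning_def nth_append)
    moreover have "wp scan_arc_prog (\<lambda>T \<sigma>'. \<sigma>' = \<tau> \<and> T \<le> 60) \<sigma>"
      using fin a mem by (simp add: scan_arc_prog_def \<tau>_def)
    ultimately show ?thesis
      by (elim wp_mono) (simp add: \<tau>_def)
  qed
qed

lemma wp_scan:
  assumes "scanning \<sigma> [] (out (queue \<sigma> ! nreg \<sigma> ''qh''))"
    and "\<And>T \<sigma>'. scanning \<sigma>' (out (queue \<sigma>' ! nreg \<sigma>' ''qh'')) [] \<Longrightarrow>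
      nreg \<sigma>' ''qh'' = nreg \<sigma> ''qh'' \<Longrightarrow>
      T + 70 * (M - nreg \<sigma>' ''c'') \<le> 70 * (M - nreg \<sigma> ''c'') + 4 \<Longrightarrow> Q T \<sigma>'"
  shows "wp (While (NLess (NConst 0) (NReg ''a'')) scan_arc_prog) Q \<sigma>"
proof (rule wp_While[where \<Phi> = "\<lambda>\<tau>. 70 * (M - nreg \<tau> ''c'')" and
      I = "\<lambda>\<tau>. (\<exists>ys xs. scanning \<tau> ys xs) \<and> nreg \<tau> ''qh'' = nreg \<sigma> ''qh''"])
  fix \<tau>
  assume I: "(\<exists>ys xs. scanning \<tau> ys xs) \<and> nreg \<tau> ''qh'' = nreg \<sigma> ''qh''"
    and b: "bval (NLess (NConst 0) (NReg ''a'')) \<tau>"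
  \<comment> \<open>A nonzero link in \<open>a\<close> means that the remaining list is nonempty,
    since 0 encodes its end.\<close>
  then obtain ys e xs where sc: "scanning \<tau> ys (e # xs)"
    by (metis bval.simps(1) chain.simps(1) less_numeral_extra(3) list.exhaust nval.simps(1,2) scanning_def)
  then show "wp scan_arc_prog (\<lambda>T \<tau>'. ((\<exists>ys xs. scanning \<tau>' ys xs) \<and>
      nreg \<tau>' ''qh'' = nreg \<sigma> ''qh'') \<and>
      bcost (NLess (NConst 0) (NReg ''a'')) + T + 1 + 70 * (M - nreg \<tau>' ''c'')
      \<le> 70 * (M - nreg \<tau> ''c'')) \<tau>"
    using I scanning_less[OF sc] by (intro wp_mono[OF wp_scan_arc[OF sc]]) auto
next
  fix T \<tau>
  assume I: "(\<exists>ys xs. scanning \<tau> ys xs) \<and> nreg \<tau> ''qh'' = nreg \<sigma> ''qh''"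
    and b: "\<not> bval (NLess (NConst 0) (NReg ''a'')) \<tau>"
    and T: "T + 70 * (M - nreg \<tau> ''c'') \<le> 70 * (M - nreg \<sigma> ''c'') +
      bcost (NLess (NConst 0) (NReg ''a'')) + 1"
  then obtain ys xs where sc: "scanning \<tau> ys xs" by blast
  moreover have "xs = []"
    using sc b by (simp add: scanning_def)
  ultimately have "scanning \<tau> (out (queue \<tau> ! nreg \<tau> ''qh'')) []"
    by (simp add: scanning_def)
  with I T show "Q T \<tau>"
    by (intro assms(2)) simp_all
qed (use assms(1) in blast)

text \<open>Amortised count: 70 units per arc cover the inner loop over all vertices together, and
  30 per queue position cover the rest of an outer iteration.\<close>

lemma wp_bfs:
  assumes "input \<sigma>" "linked \<sigma>" "\<forall>v<N. narr \<sigma> ''finite'' v = 0"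
    and post: "\<And>T \<sigma>'. T \<le> 70 * M + 30 * N + 30 \<Longrightarrow> bfs_state \<sigma>' \<Longrightarrow>
      set (queue \<sigma>') = {v. s \<rightarrow>\<^sup>* v} \<Longrightarrow>
      order \<sigma>' = concat (map out (queue \<sigma>')) \<Longrightarrow> Q T \<sigma>'"
  shows "wp bfs_prog Q \<sigma>"
proof (simp add: bfs_prog_def,
    rule wp_While[where \<Phi> = "\<lambda>\<tau>. 70 * (M - nreg \<tau> ''c'') + 30 * (N - nreg \<tau> ''qh'')" and
      I = "\<lambda>\<tau>. bfs_state \<tau> \<and> order \<tau> = concat (map out (take (nreg \<tau> ''qh'') (queue \<tau>)))"],
      goal_cases)
  case 1
  have "s \<in> verts G"
    using source by (simp add: verts_eq)
  then have "walk_costs w s ((rarr \<sigma> ''bound'')(s := 0)) {s}"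
    by (auto simp: walk_costs_def awalk_Nil_iff intro: exI[of _ "[]"])
  then show ?case
    using assms(1-3) bfs_inv_init[OF \<open>s \<in> verts G\<close>]
    by (simp add: bfs_state_def input_def linked_def queue_def order_def)
next
  case (2 \<tau>)
  then have h: "nreg \<tau> ''qh'' < length (queue \<tau>)"
    by simp
  have "queue \<tau> ! nreg \<tau> ''qh'' \<in> verts G"
    using 2 h by (auto simp: bfs_state_def bfs_inv_def intro: reachable_in_verts(2))
  define \<rho> where "\<rho> = \<tau>\<lparr>nreg := (nreg \<tau>)(''a'' := narr \<tau> ''first'' (queue \<tau> ! nreg \<tau> ''qh''))\<rparr>"
  have [simp]: "queue \<rho> = queue \<tau>" "order \<rho> = order \<tau>"
    by (simp_all add: \<rho>_def queue_def order_def)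
  have "bfs_state \<rho>"
    using 2 by (simp add: bfs_state_def input_def linked_def) (simp add: \<rho>_def)
  moreover have "chain (narr \<tau> ''next'') (nreg \<rho> ''a'') (out (queue \<tau> ! nreg \<tau> ''qh''))"
    using 2 \<open>_ \<in> verts G\<close> by (simp add: \<rho>_def bfs_state_def linked_def verts_eq)
  ultimately have sc: "scanning \<rho> [] (out (queue \<rho> ! nreg \<rho> ''qh''))"
    using 2 h by (simp add: scanning_def) (simp add: \<rho>_def)
  have \<rho>: "\<tau>\<lparr>nreg := (nreg \<tau>)(''a'' :=
      nval (NArr ''first'' (NArr ''queue'' (NReg ''qh''))) \<tau>)\<rparr> = \<rho>"
    using h by (simp add: \<rho>_def queue_def)
  have h_less: "nreg \<tau> ''qh'' < N"
    using h 2 bfs_inv_length_le[of "queue \<tau>"] by (fastforce simp: bfs_state_def)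
  show ?case
    unfolding wp_simps \<rho>
  proof (rule wp_scan[OF sc], goal_cases)
    case (1 T \<upsilon>)
    define \<upsilon>' where "\<upsilon>' = \<upsilon>\<lparr>nreg := (nreg \<upsilon>)(''qh'' := Suc (nreg \<upsilon> ''qh''))\<rparr>"
    have [simp]: "queue \<upsilon>' = queue \<upsilon>" "order \<upsilon>' = order \<upsilon>"
      by (simp_all add: \<upsilon>'_def queue_def order_def)
    \<comment> \<open>The inner loop ended with no arcs left, so every out-neighbour of the head
      vertex is in the queue.\<close>
    have "bfs_inv s (queue \<upsilon>) (Suc (nreg \<upsilon> ''qh''))"
      using 1(1) by (intro bfs_inv_next) (simp_all add: scanning_def bfs_state_def flip: set_out)
    then have "bfs_state \<upsilon>'"
      using 1(1) by (simp add: scanning_def bfs_state_def input_def linked_def) (simp add: \<upsilon>'_def)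
    moreover have "order \<upsilon>' = concat (map out (take (nreg \<upsilon>' ''qh'') (queue \<upsilon>')))"
      using 1(1) by (simp add: scanning_def take_Suc_conv_app_nth) (simp add: \<upsilon>'_def take_Suc_conv_app_nth)
    ultimately show ?case
      using 1 h_less by (simp add: \<upsilon>'_def \<rho>_def)
  qed
next
  case (3 T \<tau>)
  have "bfs_inv s (queue \<tau>) (nreg \<tau> ''qh'')"
    using 3(1) by (simp add: bfs_state_def)
  moreover from this have h: "nreg \<tau> ''qh'' = length (queue \<tau>)"
    using 3(2) by (simp add: bfs_inv_def)
  ultimately have inv: "bfs_inv s (queue \<tau>) (length (queue \<tau>))"
    by simp
  have "set (queue \<tau>) = {v. s \<rightarrow>\<^sup>* v}"
    using bfs_inv_complete[OF inv] inv unfolding bfs_inv_def by blast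
  with 3 h show ?case
    by (intro post) simp_all
qed

section \<open>All passes, and the total running time\<close>

lemma wp_relax:
  assumes "input \<sigma>" "set (order \<sigma>) \<subseteq> arcs G" "nreg \<sigma> ''c'' \<le> M"
    and post: "\<And>T \<sigma>'. T \<le> (t + 1) * (40 * M + 30) + 30 \<Longrightarrow>
      narr \<sigma>' ''finite'' = narr \<sigma> ''finite'' \<Longrightarrow>
      rarr \<sigma>' ''bound'' = (fold (relax w) (order \<sigma>) ^^ (t + 1)) (rarr \<sigma> ''bound'') \<Longrightarrow> Q T \<sigma>'"
  shows "wp relax_prog Q \<sigma>"
  unfolding relax_prog_def wp_simps
proof (rule wp_While[where \<Phi> = "\<lambda>\<tau>. (t + 1 - nreg \<tau> ''k'') * (40 * M + 30)" and
      I = "\<lambda>\<tau>. input \<tau> \<and> nreg \<tau> ''k'' \<le> t + 1 \<and> order \<tau> = order \<sigma> \<and> nreg \<tau> ''c'' \<le> M \<and>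
        narr \<tau> ''finite'' = narr \<sigma> ''finite'' \<and>
        rarr \<tau> ''bound'' = (fold (relax w) (order \<sigma>) ^^ nreg \<tau> ''k'') (rarr \<sigma> ''bound'')"],
      goal_cases)
  case 1
  then show ?case
    using assms(1-3) by (simp add: input_def order_def)
next
  case (2 \<tau>)
  define \<rho> where "\<rho> = \<tau>\<lparr>nreg := (nreg \<tau>)(''i'' := 0)\<rparr>"
  have \<rho>: "input \<rho>" "nreg \<rho> ''i'' = 0" "order \<rho> = order \<tau>"
    using 2 by (simp_all add: \<rho>_def input_def order_def)
  have k: "nreg \<tau> ''k'' < t + 1"
    using 2 by (simp add: input_def)
  \<comment> \<open>Naming the number of remaining passes as \<open>Suc d\<close> makes the drop of
    the product budget by \<open>40 * M + 30\<close> linear arithmetic.\<close>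
  then obtain d where d: "t + 1 - nreg \<tau> ''k'' = Suc d" "t - nreg \<tau> ''k'' = d"
    by (metis Suc_diff_le Suc_eq_plus1 less_Suc_eq_le)
  have "wp pass_prog (\<lambda>T \<upsilon>. input \<upsilon> \<and> T \<le> 40 * M + 4 \<and> order \<upsilon> = order \<sigma> \<and> nreg \<upsilon> ''c'' \<le> M \<and>
      nreg \<upsilon> ''k'' = nreg \<tau> ''k'' \<and> narr \<upsilon> ''finite'' = narr \<sigma> ''finite'' \<and>
      rarr \<upsilon> ''bound'' = fold (relax w) (order \<sigma>) (rarr \<tau> ''bound'')) \<rho>"
  proof (rule wp_pass)
    show "input \<rho>" "nreg \<rho> ''i'' = 0" "set (order \<rho>) \<subseteq> arcs G"
      using \<rho> 2 assms(2) by simp_all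
  qed (use 2 \<rho> in \<open>auto simp: \<rho>_def\<close>)
  then show ?case
    using 2 k d unfolding wp_simps nval.simps \<rho>_def[symmetric]
    by (elim wp_mono) (auto simp: input_def order_def)
next
  case (3 T \<tau>)
  then have "nreg \<tau> ''k'' = t + 1"
    by (simp add: input_def)
  with 3 show ?case
    by (intro post) simp_all
qed

lemma wp_plus_light:
  assumes "input \<sigma>"
  shows "wp plus_light_prog (\<lambda>T \<sigma>'. T \<le> 300 * ((t + 1) * (M + N)) \<and>
    (\<forall>v \<in> verts G. \<mu> w s v \<le> bound \<sigma>' v \<and> bound \<sigma>' v \<le> plus_light_dist t w s v)) \<sigma>"
  unfolding plus_light_prog_def wp_simps
proof (rule wp_clear[OF assms], rule wp_link, assumption, assumption,
    rule wp_bfs, assumption, assumption, assumption, goal_cases)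
  case (1 T1 \<sigma>1 T2 \<sigma>2 T3 \<sigma>3)
  let ?es = "order \<sigma>3"
  have inv: "bfs_inv s (queue \<sigma>3) (nreg \<sigma>3 ''qh'')" and inp: "input \<sigma>3"
    using 1 by (simp_all add: bfs_state_def)
  \<comment> \<open>These arcs supply the completeness that the relaxation argument needs, and their
    heads and tails stay among vertices with valid bounds.\<close>
  have es: "set ?es = {e \<in> arcs G. s \<rightarrow>\<^sup>* tail G e}"
    using 1 by (auto simp: set_out)
  have c: "nreg \<sigma>3 ''c'' \<le> M"
    using length_concat_out_le[of "queue \<sigma>3"] 1 inv
    by (metis bfs_inv_def length_order)
  have "set ?es \<subseteq> arcs G"
    using es by auto
  then show ?case
  proof (rule wp_relax[OF inp _ c], goal_cases)
    case inner: (1 T4 \<sigma>4)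
    define d where "d = rarr \<sigma>3 ''bound''"
    have d4: "rarr \<sigma>4 ''bound'' = (fold (relax w) ?es ^^ (t + 1)) d"
      unfolding d_def by (rule inner)
    have "walk_costs w s d {v. s \<rightarrow>\<^sup>* v}" "d s = 0"
      using 1 by (auto simp: bfs_state_def d_def)
    then have costs: "walk_costs w s (rarr \<sigma>4 ''bound'') {v. s \<rightarrow>\<^sup>* v}"
      unfolding d4 using es by (intro walk_costs_passes) auto
    have sorted: "sorted_wrt (\<lambda>a b. hops s (tail G a) \<le> hops s (tail G b)) ?es"
      using sorted_wrt_hops_concat[of s "queue \<sigma>3" out] set_out inv 1 by (simp add: bfs_inv_def)
    have bound: "bound \<sigma>4 v = (if s \<rightarrow>\<^sup>* v then ereal (rarr \<sigma>4 ''bound'' v) else \<infinity>)"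
      if "v \<in> verts G" for v
      using 1 inner that by (auto simp: bound_def bfs_state_def verts_eq)
    have "\<mu> w s v \<le> bound \<sigma>4 v \<and> bound \<sigma>4 v \<le> plus_light_dist t w s v" if "v \<in> verts G" for v
    proof (cases "s \<rightarrow>\<^sup>* v")
      case True
      then obtain p where "awalk s p v" "awalk_cost w p = rarr \<sigma>4 ''bound'' v"
        using costs by (auto simp: walk_costs_def)
      then have "\<mu> w s v \<le> ereal (rarr \<sigma>4 ''bound'' v)"
        using min_cost_le_walk_cost[of s p v w] by simp
      moreover have "rarr \<sigma>4 ''bound'' v \<le> awalk_cost w p" if "plus_light t s p v" for p
        unfolding d4 using es \<open>d s = 0\<close> that
        by (intro relax_passes_plus_light[OF sorted]) auto
      ultimately show ?thesis
        using True bound[OF that] by (auto simp: plus_light_dist_def intro: INF_greatest)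
    next
      case False
      \<comment> \<open>The infimum is over the empty set, matching the flag that is still
        0.\<close>
      then have "plus_light_dist t w s v = \<infinity>"
        by (simp add: plus_light_dist_def plus_light_iff reachable_awalk top_ereal_def)
      then show ?thesis
        using False bound[OF that] by simp
    qed
    moreover have "T1 + (T2 + (T3 + T4)) \<le> 300 * ((t + 1) * (M + N))"
    proof -
      let ?S = "(t + 1) * (M + N)"
      have "M + N \<le> ?S" by simp
      \<comment> \<open>The source gives \<open>N \<ge> 1\<close>, so additive constants are
        absorbed into multiples of \<open>N\<close>.\<close>
      moreover have "(t + 1) * (40 * M + 30) \<le> (t + 1) * (40 * (M + N))"
        using source by (intro mult_le_mono2) simp
      then have "(t + 1) * (40 * M + 30) \<le> 40 * ?S"
        by (simp only: ac_simps)
      ultimately show ?thesis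
        using 1(1,4) 1(8) inner source by linarith
    qed
    ultimately show ?case by blast
  qed
qed

end

theorem theorem1:
  "\<exists>(P :: com) (C :: nat).
     \<forall>(G :: (nat, nat) pre_digraph) (w :: nat \<Rightarrow> real) (s :: nat) (t :: nat) (\<sigma> :: state).
       fin_digraph G \<longrightarrow> s \<in> verts G \<longrightarrow> t > 0 \<longrightarrow> encodes \<sigma> G w s t \<longrightarrow>
       (\<exists>T \<sigma>'. exec P \<sigma> T \<sigma>' \<and>
          T \<le> C * ((t + 1) * (card (arcs G) + card (verts G))) \<and>
          (\<forall>v \<in> verts G - {s}.
             wf_digraph.\<mu> G w s v \<le> bound \<sigma>' v \<and>
             bound \<sigma>' v \<le> wf_digraph.plus_light_dist G t w s v))"
proof (rule exI[of _ plus_light_prog], rule exI[of _ 300], intro allI impI)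
  fix G :: "(nat, nat) pre_digraph" and w :: "nat \<Rightarrow> real" and s t \<sigma>
  assume "fin_digraph G" and s: "s \<in> verts G" and enc: "encodes \<sigma> G w s t"
  have verts: "verts G = {..<nreg \<sigma> ''n''}" and arcs: "arcs G = {..<nreg \<sigma> ''m''}"
    using enc by (simp_all add: encodes_def)
  interpret fin_digraph G by fact
  interpret source_instance G w s t "nreg \<sigma> ''n''" "nreg \<sigma> ''m''"
    using s by unfold_locales (simp_all add: verts arcs)
  show "\<exists>T \<sigma>'. exec plus_light_prog \<sigma> T \<sigma>' \<and>
      T \<le> 300 * ((t + 1) * (card (arcs G) + card (verts G))) \<and>
      (\<forall>v \<in> verts G - {s}. \<mu> w s v \<le> bound \<sigma>' v \<and> bound \<sigma>' v \<le> plus_light_dist t w s v)"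
    using wp_plus_light[OF input_if_encodes[OF enc]] unfolding wp_def
    by (auto simp: verts arcs simp del: distrib_left_numeral mult_Suc)
qed

end
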